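(* Let $(u_n)_{n\ge 0}$ be a sequence of fuzzy numbers. If $(u_n)$ is Cesàro summable, then $D(u_n,\bar 0)=o(n)$, i.e. $\lim_{n\to\infty} D(u_n,\bar 0)/n=0$. Moreover, this estimate is best possible, in the following sense: for every sequence $(\lambda_n)$ of positive real numbers which is not bounded (i.e. $0<\lambda_n\neq O(1)$), there exists a Cesàro summable sequence $(u_n)$ of fuzzy numbers for which the estimate $D(u_n,\bar 0)=o\left(\frac{n}{\lambda_n}\right)$ fails.
   Context: A fuzzy number is a function $u:\mathbb{R}\to[0,1]$ that is normal ($u(t_0)=1$ for some $t_0$), fuzzy convex ($u(\lambda s+(1-\lambda)t)\ge\min\{u(s),u(t)\}$ for $s,t\in\mathbb{R}$, $\lambda\in[0,1]$), upper semicontinuous, and has compact support $\overline{\{t:u(t)>0\}}$. The set of fuzzy numbers is $E^1$. For $u\in E^1$ the $\alpha$-level set is $[u]_\alpha=\{t:u(t)\ge\alpha\}$ for $0<\alpha\le1$ and $[u]_0=\overline{\{t:u(t)>0\}}$; it is a compact interval, written $[u]_\alpha=[u^-_\alpha,u^+_\alpha]$. Addition and scalar multiplication ($k\in\mathbb{R}$) are defined by $[u+v]_\alpha=[u^-_\alpha+v^-_\alpha,\,u^+_\alpha+v^+_\alpha]$ and $[ku]_\alpha=k[u]_\alpha$ for all $\alpha\in[0,1]$. The metric on $E^1$ is $D(u,v)=\sup_{\alpha\in[0,1]}\max\{|u^-_\alpha-v^-_\alpha|,|u^+_\alpha-v^+_\alpha|\}$; convergence in $E^1$ means convergence with respect to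 $D$. For $r\in\mathbb{R}$, $\bar r\in E^1$ is the fuzzy number with $\bar r(r)=1$ and $\bar r(t)=0$ for $t\ne r$. A sequence $(u_n)_{n\ge0}$ of fuzzy numbers is Cesàro summable to $\mu\in E^1$ if $\sigma_n=\frac{1}{n+1}\sum_{k=0}^n u_k$ converges to $\mu$; it is Cesàro summable if it is Cesàro summable to some $\mu\in E^1$. *)

theory Defs
  imports "HOL-Analysis.Analysis" "HOL-Library.Landau_Symbols"
begin

definition upper_semicontinuous :: "(real \<Rightarrow> real) \<Rightarrow> bool" where
  "upper_semicontinuous f \<longleftrightarrow> (\<forall>t y. f t < y \<longrightarrow> (\<forall>\<^sub>F s in at t. f s < y))"

definition fuzzy_convex :: "(real \<Rightarrow> real) \<Rightarrow> bool" where
  "fuzzy_convex f \<longleftrightarrow>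
     (\<forall>s t. \<forall>c\<in>{0..1}. f (c * s + (1 - c) * t) \<ge> min (f s) (f t))"

definition is_fuzzy_number :: "(real \<Rightarrow> real) \<Rightarrow> bool" where
  "is_fuzzy_number f \<longleftrightarrow>
     range f \<subseteq> {0..1} \<and> (\<exists>t. f t = 1) \<and> fuzzy_convex f \<and>
     upper_semicontinuous f \<and> compact (closure {t. f t > 0})"

lemma is_fuzzy_number_crisp: "is_fuzzy_number (\<lambda>t. if t = r then 1 else 0)"
proof -
  let ?f = "\<lambda>t::real. if t = r then 1 else (0::real)"
  have "fuzzy_convex ?f"
    unfolding fuzzy_convex_def
  proof (intro allI ballI)
    fix s t c :: real
    have "c * r + (1 - c) * r = r" by (simp add: algebra_simps)
    then show "min (?f s) (?f t) \<le> ?f (c * s + (1 - c) * t)"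
      by (cases "s = r"; cases "t = r") (simp_all del: mult_cancel_left mult_cancel_right)
  qed
  moreover have "upper_semicontinuous ?f"
    unfolding upper_semicontinuous_def
  proof (intro allI impI)
    fix t y :: real assume *: "?f t < y"
    show "\<forall>\<^sub>F s in at t. ?f s < y"
    proof (cases "t = r")
      case True
      with * show ?thesis by (intro always_eventually) auto
    next
      case False
      have "\<forall>\<^sub>F s in at t. s \<noteq> r"
        using False by (intro eventually_neq_at_within)
      then show ?thesis by eventually_elim (use * False in auto)
    qed
  qed
  moreover have "{t. ?f t > 0} = {r}" by auto
  then have "compact (closure {t. ?f t > 0})" by (simp only:) simp
  moreover have "range ?f \<subseteq> {0..1}" by auto
  moreover have "\<exists>t. ?f t = 1" by (rule exI[of _ r]) simp
  ultimately show ?thesis unfolding is_fuzzy_number_def by blast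
qed

typedef fuzzy_number = "{f :: real \<Rightarrow> real. is_fuzzy_number f}"
  morphisms membership Fuzzy_Number
  using is_fuzzy_number_crisp by blast

definition crisp :: "real \<Rightarrow> fuzzy_number" where
  "crisp r = Fuzzy_Number (\<lambda>t. if t = r then 1 else 0)"

definition level :: "fuzzy_number \<Rightarrow> real \<Rightarrow> real set" where
  "level u \<alpha> = (if \<alpha> = 0 then closure {t. membership u t > 0} else {t. membership u t \<ge> \<alpha>})"

text \<open>By \<open>level_interval\<close> below, \<open>level u \<alpha>\<close> is the compact interval
  \<open>{lower u \<alpha>..upper u \<alpha>}\<close> for \<open>\<alpha> \<in> {0..1}\<close>.\<close>

definition lower :: "fuzzy_number \<Rightarrow> real \<Rightarrow> real" where
  "lower u \<alpha> = Inf (level u \<alpha>)"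

definition upper :: "fuzzy_number \<Rightarrow> real \<Rightarrow> real" where
  "upper u \<alpha> = Sup (level u \<alpha>)"

lemma membership_crisp: "membership (crisp r) t = (if t = r then 1 else 0)"
  unfolding crisp_def using is_fuzzy_number_crisp by (simp add: Fuzzy_Number_inverse)

lemma level_crisp: "0 \<le> \<alpha> \<Longrightarrow> \<alpha> \<le> 1 \<Longrightarrow> level (crisp r) \<alpha> = {r}"
proof -
  assume a: "0 \<le> \<alpha>" "\<alpha> \<le> 1"
  have supp: "{t. membership (crisp r) t > 0} = {r}" by (auto simp: membership_crisp)
  show ?thesis
  proof (cases "\<alpha> = 0")
    case True
    then have "level (crisp r) \<alpha> = closure {t. membership (crisp r) t > 0}"
      by (simp add: level_def)
    then show ?thesis by (simp only: supp) simp
  next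
    case False
    then show ?thesis using a by (auto simp: level_def membership_crisp)
  qed
qed

lemma fuzzy_number: "is_fuzzy_number (membership u)"
  using membership[of u] by simp

lemma membership_bounds: "0 \<le> membership u t" "membership u t \<le> 1"
  using fuzzy_number[of u] by (auto simp: is_fuzzy_number_def image_subset_iff)

lemma level_subset: 
  assumes "0 \<le> \<alpha>" "\<alpha> \<le> \<beta>"
  shows "level u \<beta> \<subseteq> level u \<alpha>"
proof (cases "\<alpha> = 0 \<and> \<beta> \<noteq> 0")
  case True
  then have "level u \<beta> \<subseteq> {t. membership u t > 0}" using assms by (auto simp: level_def)
  also have "\<dots> \<subseteq> level u \<alpha>" using True by (simp add: level_def closure_subset)
  finally show ?thesis .
next
  case False
  then show ?thesis using assms by (auto simp: level_def)
qed

lemma closed_superlevel: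
  assumes "upper_semicontinuous f"
  shows "closed {t. f t \<ge> \<alpha>}"
proof -
  have "open {t. f t < \<alpha>}"
    unfolding open_dist
  proof (intro ballI)
    fix x assume "x \<in> {t. f t < \<alpha>}"
    then have x: "f x < \<alpha>" by simp
    then have "\<forall>\<^sub>F s in at x. f s < \<alpha>" using assms by (auto simp: upper_semicontinuous_def)
    then obtain d where "d > 0" "\<And>s. s \<noteq> x \<Longrightarrow> dist s x < d \<Longrightarrow> f s < \<alpha>"
      by (auto simp: eventually_at)
    then show "\<exists>e>0. \<forall>y. dist y x < e \<longrightarrow> y \<in> {t. f t < \<alpha>}"
      using x by (metis mem_Collect_eq)
  qed
  moreover have "{t. f t \<ge> \<alpha>} = - {t. f t < \<alpha>}" by auto
  ultimately show ?thesis by (simp add: closed_def)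
qed

lemma fuzzy_convex_convex:
  assumes "fuzzy_convex f" "\<And>x y. P x \<Longrightarrow> x \<le> y \<Longrightarrow> P y"
  shows "convex {t. P (f t)}"
  unfolding convex_alt
proof (intro ballI allI impI, elim conjE)
  fix x y c :: real
  assume xy: "x \<in> {t. P (f t)}" "y \<in> {t. P (f t)}" "0 \<le> c" "c \<le> 1"
  have "min (f y) (f x) \<le> f (c * y + (1 - c) * x)"
    using assms(1) xy unfolding fuzzy_convex_def by auto
  moreover have "P (min (f y) (f x))" using xy by (auto simp: min_def)
  ultimately have "P (f (c * y + (1 - c) * x))" using assms(2) by blast
  then show "(1 - c) *\<^sub>R x + c *\<^sub>R y \<in> {t. P (f t)}" by (simp add: add.commute)
qed

lemma level_interval:
  assumes "0 \<le> \<alpha>" "\<alpha> \<le> 1"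
  shows "level u \<alpha> = {lower u \<alpha>..upper u \<alpha>}" "lower u \<alpha> \<le> upper u \<alpha>"
proof -
  let ?f = "membership u"
  have f: "fuzzy_convex ?f" "upper_semicontinuous ?f" "compact (level u 0)" "\<exists>t. ?f t = 1"
    using fuzzy_number[of u] by (auto simp: is_fuzzy_number_def level_def)
  have "closed (level u \<alpha>)"
    using closed_superlevel[OF f(2)] by (auto simp: level_def)
  then have "compact (level u \<alpha>)"
    using level_subset[of 0 \<alpha> u] assms f(3)
    by (metis compact_Int_closed inf.absorb_iff2 order_refl)
  moreover have "convex (level u \<alpha>)"
    using fuzzy_convex_convex[OF f(1), of "\<lambda>y. y \<ge> \<alpha>"] fuzzy_convex_convex[OF f(1), of "\<lambda>y. y > 0"]
    by (auto simp: level_def intro!: convex_closure)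
  ultimately obtain a b where ab: "level u \<alpha> = {a..b}"
    using connected_compact_interval_1[of "level u \<alpha>"] convex_connected by blast
  obtain t where "?f t = 1" using f(4) by auto
  then have "t \<in> level u 1" by (simp add: level_def)
  then have "t \<in> level u \<alpha>" using level_subset assms by blast
  with ab have "a \<le> b" by auto
  then show "level u \<alpha> = {lower u \<alpha>..upper u \<alpha>}" "lower u \<alpha> \<le> upper u \<alpha>"
    using ab by (auto simp: lower_def upper_def)
qed

lemma level_eqI:
  assumes "\<forall>\<alpha>\<in>{0..1}. level u \<alpha> = level v \<alpha>"
  shows "u = v"
proof -
  have "membership u t = membership v t" for t
  proof -
    have *: "membership u t \<le> membership v t" 
      if "\<forall>\<alpha>\<in>{0..1}. level u \<alpha> = level v \<alpha>" for u v
    proof (cases "membership u t = 0")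
      case True
      then show ?thesis using membership_bounds by simp
    next
      case False
      have "t \<in> level u (membership u t)" using False by (simp add: level_def)
      then have "t \<in> level v (membership u t)" using that membership_bounds by auto
      then show ?thesis using False by (simp add: level_def)
    qed
    show ?thesis using *[of u v] *[of v u] assms by fastforce
  qed
  then show ?thesis by (metis ext membership_inject)
qed

lemma lower_upper_mono:
  assumes "0 \<le> \<alpha>" "\<alpha> \<le> \<beta>" "\<beta> \<le> 1"
  shows "lower u \<alpha> \<le> lower u \<beta>" "upper u \<beta> \<le> upper u \<alpha>"
  using level_subset[of \<alpha> \<beta> u] level_interval[of \<alpha> u] level_interval[of \<beta> u] assms by auto

lemma lower_left:
  assumes "0 < \<alpha>" "\<alpha> \<le> 1" "e > 0"
  shows "\<exists>\<beta>. 0 < \<beta> \<and> \<beta> < \<alpha> \<and> lower u \<beta> > lower u \<alpha> - e"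
proof (rule ccontr)
  assume n: "\<not> ?thesis"
  let ?c = "lower u \<alpha> - e"
  have "membership u ?c \<ge> \<beta>" if b: "0 < \<beta>" "\<beta> < \<alpha>" for \<beta>
  proof -
    have "?c \<in> level u \<beta>"
      using n b assms lower_upper_mono[of \<beta> \<alpha> u] level_interval[of \<beta> u] level_interval[of \<alpha> u]
      by force
    then show ?thesis using b by (simp add: level_def)
  qed
  then have "membership u ?c \<ge> \<alpha>" using assms(1) by (rule dense_le_bounded[rotated]) auto
  then have "?c \<in> level u \<alpha>" using assms by (simp add: level_def)
  then show False using level_interval[of \<alpha> u] assms by auto
qed

lemma upper_left:
  assumes "0 < \<alpha>" "\<alpha> \<le> 1" "e > 0"
  shows "\<exists>\<beta>. 0 < \<beta> \<and> \<beta> < \<alpha> \<and> upper u \<beta> < upper u \<alpha> + e"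
proof (rule ccontr)
  assume n: "\<not> ?thesis"
  let ?c = "upper u \<alpha> + e"
  have "membership u ?c \<ge> \<beta>" if b: "0 < \<beta>" "\<beta> < \<alpha>" for \<beta>
  proof -
    have "?c \<in> level u \<beta>"
      using n b assms lower_upper_mono[of \<beta> \<alpha> u] level_interval[of \<beta> u] level_interval[of \<alpha> u]
      by force
    then show ?thesis using b by (simp add: level_def)
  qed
  then have "membership u ?c \<ge> \<alpha>" using assms(1) by (rule dense_le_bounded[rotated]) auto
  then have "?c \<in> level u \<alpha>" using assms by (simp add: level_def)
  then show False using level_interval[of \<alpha> u] assms by auto
qed

lemma level_0_approx:
  assumes "c \<in> level u 0" "e > 0"
  shows "\<exists>\<beta>. 0 < \<beta> \<and> \<beta> \<le> 1 \<and> lower u \<beta> < c + e \<and> upper u \<beta> > c - e"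
proof -
  obtain s where s: "membership u s > 0" "dist s c < e"
    using assms by (auto simp: level_def closure_approachable)
  have "s \<in> level u (membership u s)" using s by (simp add: level_def)
  then show ?thesis
    using s membership_bounds[of u s] level_interval[of "membership u s" u]
    by (intro exI[of _ "membership u s"]) (auto simp: dist_real_def)
qed

lemma exists_fuzzy_number:
  fixes l r :: "real \<Rightarrow> real"
  assumes mono: "\<And>\<alpha> \<beta>. 0 \<le> \<alpha> \<Longrightarrow> \<alpha> \<le> \<beta> \<Longrightarrow> \<beta> \<le> 1 \<Longrightarrow> l \<alpha> \<le> l \<beta> \<and> r \<beta> \<le> r \<alpha>"
    and "l 1 \<le> r 1"
    and left: "\<And>\<alpha> e. 0 < \<alpha> \<Longrightarrow> \<alpha> \<le> 1 \<Longrightarrow> e > 0 \<Longrightarrow> \<exists>\<beta>. 0 < \<beta> \<and> \<beta> < \<alpha> \<and> l \<beta> > l \<alpha> - e"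
      "\<And>\<alpha> e. 0 < \<alpha> \<Longrightarrow> \<alpha> \<le> 1 \<Longrightarrow> e > 0 \<Longrightarrow> \<exists>\<beta>. 0 < \<beta> \<and> \<beta> < \<alpha> \<and> r \<beta> < r \<alpha> + e"
    and right: "\<And>e. e > 0 \<Longrightarrow> \<exists>\<beta>. 0 < \<beta> \<and> \<beta> \<le> 1 \<and> l \<beta> < l 0 + e"
      "\<And>e. e > 0 \<Longrightarrow> \<exists>\<beta>. 0 < \<beta> \<and> \<beta> \<le> 1 \<and> r \<beta> > r 0 - e"
  shows "\<exists>w. \<forall>\<alpha>\<in>{0..1}. level w \<alpha> = {l \<alpha>..r \<alpha>}"
proof -
  define A where "A t = {\<alpha>. 0 \<le> \<alpha> \<and> \<alpha> \<le> 1 \<and> (\<alpha> = 0 \<or> l \<alpha> \<le> t \<and> t \<le> r \<alpha>)}" for t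
  define f where "f t = Sup (A t)" for t
  have A0: "0 \<in> A t" and bdd: "bdd_above (A t)" for t
    by (auto simp: A_def intro!: bdd_aboveI[of _ 1])
  have f01: "0 \<le> f t" "f t \<le> 1" for t
  proof -
    show "0 \<le> f t" unfolding f_def using A0 bdd by (rule cSup_upper)
    have "A t \<noteq> {}" using A0[of t] by blast
    then show "f t \<le> 1" unfolding f_def by (rule cSup_least) (auto simp: A_def)
  qed
  have f_ge: "f t \<ge> \<alpha> \<longleftrightarrow> t \<in> {l \<alpha>..r \<alpha>}" if a: "0 < \<alpha>" "\<alpha> \<le> 1" for t \<alpha>
  proof
    assume "t \<in> {l \<alpha>..r \<alpha>}"
    then have "\<alpha> \<in> A t" using a by (auto simp: A_def)
    then show "f t \<ge> \<alpha>" unfolding f_def using bdd by (rule cSup_upper)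
  next
    assume f: "f t \<ge> \<alpha>"
    have b: "l \<beta> \<le> t \<and> t \<le> r \<beta>" if b: "0 < \<beta>" "\<beta> < \<alpha>" for \<beta>
    proof -
      have "\<beta> < Sup (A t)" using f b by (simp add: f_def)
      then obtain \<gamma> where "\<gamma> \<in> A t" "\<beta> < \<gamma>" using less_cSupD[of "A t"] A0 by blast
      then show ?thesis using b mono[of \<beta> \<gamma>] by (auto simp: A_def)
    qed
    have "l \<alpha> \<le> t"
    proof (rule ccontr)
      assume "\<not> ?thesis"
      then obtain \<beta> where "0 < \<beta>" "\<beta> < \<alpha>" "l \<beta> > l \<alpha> - (l \<alpha> - t)" 
        using left(1)[of \<alpha> "l \<alpha> - t"] a by auto
      then show False using b[of \<beta>] by simp
    qed
    moreover have "t \<le> r \<alpha>"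
    proof (rule ccontr)
      assume "\<not> ?thesis"
      then obtain \<beta> where "0 < \<beta>" "\<beta> < \<alpha>" "r \<beta> < r \<alpha> + (t - r \<alpha>)" 
        using left(2)[of \<alpha> "t - r \<alpha>"] a by auto
      then show False using b[of \<beta>] by simp
    qed
    ultimately show "t \<in> {l \<alpha>..r \<alpha>}" by simp
  qed
  have supp: "closure {t. f t > 0} = {l 0..r 0}"
  proof
    have "{t. f t > 0} \<subseteq> {l 0..r 0}"
    proof
      fix t assume "t \<in> {t. f t > 0}"
      then show "t \<in> {l 0..r 0}" using f_ge[of "f t" t] f01[of t] mono[of 0 "f t"] by auto
    qed
    then show "closure {t. f t > 0} \<subseteq> {l 0..r 0}" by (simp add: closure_minimal)
    show "{l 0..r 0} \<subseteq> closure {t. f t > 0}"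
    proof
      fix t assume t: "t \<in> {l 0..r 0}"
      show "t \<in> closure {t. f t > 0}"
        unfolding closure_approachable
      proof (intro allI impI)
        fix e :: real assume e: "0 < e"
        obtain \<beta> where b: "0 < \<beta>" "\<beta> \<le> 1" "l \<beta> < l 0 + e" using right(1) e by blast
        obtain \<gamma> where g: "0 < \<gamma>" "\<gamma> \<le> 1" "r \<gamma> > r 0 - e" using right(2) e by blast
        define \<delta> where "\<delta> = min \<beta> \<gamma>"
        have d0: "0 < \<delta>" "\<delta> \<le> \<beta>" "\<delta> \<le> \<gamma>" "\<delta> \<le> 1" using b g by (auto simp: \<delta>_def)
        then have d: "0 < \<delta>" "\<delta> \<le> 1" "l \<delta> < l 0 + e" "r \<delta> > r 0 - e" "l \<delta> \<le> r \<delta>"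
          using b g mono[of \<delta> \<beta>] mono[of \<delta> \<gamma>] mono[of \<delta> 1] \<open>l 1 \<le> r 1\<close> by auto
        define s where "s = max (l \<delta>) (min t (r \<delta>))"
        have "s \<in> {l \<delta>..r \<delta>}" using d by (auto simp: s_def)
        then have "f s > 0" using f_ge[of \<delta> s] d by simp
        moreover have "dist s t < e" using d t e by (auto simp: s_def dist_real_def)
        ultimately show "\<exists>y\<in>{t. f t > 0}. dist y t < e" by blast
      qed
    qed
  qed
  have "is_fuzzy_number f"
    unfolding is_fuzzy_number_def
  proof (intro conjI)
    show "range f \<subseteq> {0..1}" using f01 by auto
    have "f (l 1) \<ge> 1" using f_ge[of 1 "l 1"] \<open>l 1 \<le> r 1\<close> by auto
    then show "\<exists>t. f t = 1" using f01 by (meson antisym)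
    show "compact (closure {t. f t > 0})" by (simp add: supp)
    show "fuzzy_convex f"
      unfolding fuzzy_convex_def
    proof (intro allI ballI)
      fix s t c :: real assume c: "c \<in> {0..1}"
      let ?m = "min (f s) (f t)"
      show "?m \<le> f (c * s + (1 - c) * t)"
      proof (cases "?m = 0")
        case True then show ?thesis using f01 by simp
      next
        case False
        then have m: "0 < ?m" "?m \<le> 1" using f01[of s] f01[of t] by (auto simp: min_def)
        have "s \<in> {l ?m..r ?m}" by (rule iffD1[OF f_ge[OF m]]) (rule min.cobounded1)
        moreover have "t \<in> {l ?m..r ?m}" by (rule iffD1[OF f_ge[OF m]]) (rule min.cobounded2)
        ultimately have "c *\<^sub>R s + (1 - c) *\<^sub>R t \<in> {l ?m..r ?m}"
          using c by (intro convexD) auto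
        then have "f (c *\<^sub>R s + (1 - c) *\<^sub>R t) \<ge> ?m" by (rule iffD2[OF f_ge[OF m]])
        then show ?thesis by simp
      qed
    qed
    show "upper_semicontinuous f"
      unfolding upper_semicontinuous_def
    proof (intro allI impI)
      fix t y assume y: "f t < y"
      show "\<forall>\<^sub>F s in at t. f s < y"
      proof (cases "y \<le> 1")
        case False
        then show ?thesis using f01(2) by (intro always_eventually) (meson le_less_trans not_le)
      next
        case True
        have y0: "0 < y" using y f01(1)[of t] by linarith
        have "open (- {l y..r y})" by auto
        moreover have "t \<in> - {l y..r y}" using f_ge[of y t] y y0 True by auto
        ultimately have "\<forall>\<^sub>F s in at t. s \<in> - {l y..r y}"
          using eventually_at_topological by blast
        then show ?thesis by eventually_elim (use f_ge[OF y0 True] in force)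
      qed
    qed
  qed
  then have m: "membership (Fuzzy_Number f) = f" by (simp add: Fuzzy_Number_inverse)
  have "\<forall>\<alpha>\<in>{0..1}. level (Fuzzy_Number f) \<alpha> = {l \<alpha>..r \<alpha>}"
    using supp f_ge by (auto simp: level_def m)
  then show ?thesis by blast
qed

lemma lower_upper_eqI:
  assumes "\<forall>\<alpha>\<in>{0..1}. lower u \<alpha> = lower v \<alpha> \<and> upper u \<alpha> = upper v \<alpha>"
  shows "u = v"
  using assms by (intro level_eqI) (auto simp: level_interval)

instantiation fuzzy_number :: "{zero, plus, scaleR}"
begin

definition zero_fuzzy_number :: fuzzy_number where
  "0 = crisp 0"

text \<open>Both operations are given by their level sets; \<open>level_plus\<close> and \<open>level_scaleR\<close> below show
  that the described fuzzy number exists, and \<open>level_eqI\<close> that it is unique.\<close>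

definition plus_fuzzy_number :: "fuzzy_number \<Rightarrow> fuzzy_number \<Rightarrow> fuzzy_number" where
  "u + v = (THE w. \<forall>\<alpha>\<in>{0..1}.
     level w \<alpha> = {lower u \<alpha> + lower v \<alpha>..upper u \<alpha> + upper v \<alpha>})"

definition scaleR_fuzzy_number :: "real \<Rightarrow> fuzzy_number \<Rightarrow> fuzzy_number" where
  "k *\<^sub>R u = (THE w. \<forall>\<alpha>\<in>{0..1}. level w \<alpha> = (\<lambda>t. k * t) ` level u \<alpha>)"

instance ..

end

lemma the_level:
  assumes "\<exists>w. \<forall>\<alpha>\<in>{0..1}. level w \<alpha> = K \<alpha>" "0 \<le> \<alpha>" "\<alpha> \<le> 1"
  shows "level (THE w. \<forall>\<alpha>\<in>{0..1}. level w \<alpha> = K \<alpha>) \<alpha> = K \<alpha>"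
proof -
  have "\<exists>!w. \<forall>\<alpha>\<in>{0..1}. level w \<alpha> = K \<alpha>"
    using assms(1) by (auto intro!: level_eqI)
  from theI'[OF this] show ?thesis using assms by auto
qed

lemma level_plus:
  assumes a: "0 \<le> \<alpha>" "\<alpha> \<le> 1"
  shows "level (u + v) \<alpha> = {lower u \<alpha> + lower v \<alpha>..upper u \<alpha> + upper v \<alpha>}"
  unfolding plus_fuzzy_number_def
proof (rule the_level[OF exists_fuzzy_number a])
  have e2: "e / 2 > 0" if "e > 0" for e :: real using that by simp
  show "lower u \<alpha> + lower v \<alpha> \<le> lower u \<beta> + lower v \<beta> \<and>
        upper u \<beta> + upper v \<beta> \<le> upper u \<alpha> + upper v \<alpha>"
    if "0 \<le> \<alpha>" "\<alpha> \<le> \<beta>" "\<beta> \<le> 1" for \<alpha> \<beta>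
    using lower_upper_mono[OF that, of u] lower_upper_mono[OF that, of v] by simp
  show "lower u 1 + lower v 1 \<le> upper u 1 + upper v 1"
    using level_interval(2)[of 1 u] level_interval(2)[of 1 v] by simp
  fix e :: real assume e: "e > 0"
  {
    fix \<alpha> :: real assume al: "0 < \<alpha>" "\<alpha> \<le> 1"
    obtain b c where bc: "0 < b" "b < \<alpha>" "lower u b > lower u \<alpha> - e/2"
      "0 < c" "c < \<alpha>" "lower v c > lower v \<alpha> - e/2"
      using lower_left[OF al e2[OF e]] by meson
    then show "\<exists>\<beta>. 0 < \<beta> \<and> \<beta> < \<alpha> \<and> lower u \<beta> + lower v \<beta> > lower u \<alpha> + lower v \<alpha> - e"
      using al lower_upper_mono[of b "max b c" u] lower_upper_mono[of c "max b c" v]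
      by (intro exI[of _ "max b c"]) auto
    obtain b c where bc: "0 < b" "b < \<alpha>" "upper u b < upper u \<alpha> + e/2"
      "0 < c" "c < \<alpha>" "upper v c < upper v \<alpha> + e/2"
      using upper_left[OF al e2[OF e]] by meson
    then show "\<exists>\<beta>. 0 < \<beta> \<and> \<beta> < \<alpha> \<and> upper u \<beta> + upper v \<beta> < upper u \<alpha> + upper v \<alpha> + e"
      using al lower_upper_mono[of b "max b c" u] lower_upper_mono[of c "max b c" v]
      by (intro exI[of _ "max b c"]) auto
  }
  have l0: "lower w 0 \<in> level w 0" "upper w 0 \<in> level w 0" for w
    using level_interval[of 0 w] by auto
  obtain b c where "0 < b" "b \<le> 1" "lower u b < lower u 0 + e/2"
    "0 < c" "c \<le> 1" "lower v c < lower v 0 + e/2"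
    using level_0_approx[OF l0(1) e2[OF e]] by meson
  then show "\<exists>\<beta>. 0 < \<beta> \<and> \<beta> \<le> 1 \<and> lower u \<beta> + lower v \<beta> < lower u 0 + lower v 0 + e"
    using lower_upper_mono[of "min b c" b u] lower_upper_mono[of "min b c" c v]
    by (intro exI[of _ "min b c"]) auto
  obtain b c where "0 < b" "b \<le> 1" "upper u b > upper u 0 - e/2"
    "0 < c" "c \<le> 1" "upper v c > upper v 0 - e/2"
    using level_0_approx[OF l0(2) e2[OF e]] by meson
  then show "\<exists>\<beta>. 0 < \<beta> \<and> \<beta> \<le> 1 \<and> upper u \<beta> + upper v \<beta> > upper u 0 + upper v 0 - e"
    using lower_upper_mono[of "min b c" b u] lower_upper_mono[of "min b c" c v]
    by (intro exI[of _ "min b c"]) auto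
qed

lemma level_scaleR:
  assumes a: "0 \<le> \<alpha>" "\<alpha> \<le> 1"
  shows "level (k *\<^sub>R u) \<alpha> = (\<lambda>t. k * t) ` level u \<alpha>"
  unfolding scaleR_fuzzy_number_def
proof (rule the_level[OF _ a])
  have ne: "level u \<alpha> \<noteq> {}" if "\<alpha> \<in> {0..1}" for \<alpha> 
    using level_interval[of \<alpha> u] that by simp
  show "\<exists>w. \<forall>\<alpha>\<in>{0..1}. level w \<alpha> = (\<lambda>t. k * t) ` level u \<alpha>"
  proof (cases "k = 0")
    case True
    have "level (crisp 0) \<alpha> = (\<lambda>t. k * t) ` level u \<alpha>" if "\<alpha> \<in> {0..1}" for \<alpha>
      using True ne[OF that] that by (simp add: level_crisp image_constant_conv)
    then show ?thesis by blast
  next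
    case k: False
    define f where "f t = membership u (t / k)" for t
    have preim: "{t. P (f t)} = (\<lambda>t. k * t) ` {t. P (membership u t)}" for P
    proof
      show "{t. P (f t)} \<subseteq> (\<lambda>t. k * t) ` {t. P (membership u t)}"
      proof
        fix t assume "t \<in> {t. P (f t)}"
        then have "t / k \<in> {t. P (membership u t)}" by (simp add: f_def)
        moreover have "t = k * (t / k)" using k by simp
        ultimately show "t \<in> (\<lambda>t. k * t) ` {t. P (membership u t)}" by (rule rev_image_eqI)
      qed
      show "(\<lambda>t. k * t) ` {t. P (membership u t)} \<subseteq> {t. P (f t)}"
        using k by (auto simp: f_def)
    qed
    have cl: "closure {t. f t > 0} = (\<lambda>t. k * t) ` closure {t. membership u t > 0}"
      using closure_scaleR[of k "{t. membership u t > 0}"] preim[of "\<lambda>y. y > 0"] by simp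
    have fu: "\<exists>t. membership u t = 1" "fuzzy_convex (membership u)"
        "upper_semicontinuous (membership u)" "compact (closure {t. membership u t > 0})"
      using fuzzy_number[of u] unfolding is_fuzzy_number_def by blast+
    have "is_fuzzy_number f"
      unfolding is_fuzzy_number_def
    proof (intro conjI)
      show "range f \<subseteq> {0..1}" using membership_bounds by (auto simp: f_def)
      obtain t where "membership u t = 1" using fu(1) by blast
      then show "\<exists>t. f t = 1" using k by (intro exI[of _ "k * t"]) (simp add: f_def)
      show "fuzzy_convex f"
        unfolding fuzzy_convex_def
      proof (intro allI ballI)
        fix s t c :: real assume "c \<in> {0..1}"
        then have "min (membership u (s / k)) (membership u (t / k))
            \<le> membership u (c * (s / k) + (1 - c) * (t / k))"
          using fu(2) unfolding fuzzy_convex_def by blast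
        then show "min (f s) (f t) \<le> f (c * s + (1 - c) * t)"
          by (simp add: f_def add_divide_distrib)
      qed
      show "compact (closure {t. f t > 0})"
        unfolding cl using compact_scaling[OF fu(4), of k] by simp
      show "upper_semicontinuous f"
        unfolding upper_semicontinuous_def
      proof (intro allI impI)
        fix t y assume "f t < y"
        then have "\<forall>\<^sub>F s in at (t / k). membership u s < y"
          using fu(3) unfolding f_def upper_semicontinuous_def by blast
        moreover have "filterlim (\<lambda>s. s / k) (at (t / k)) (at t)"
          using k by (auto simp: filterlim_at eventually_at_filter intro!: tendsto_intros)
        ultimately show "\<forall>\<^sub>F s in at t. f s < y"
          unfolding f_def by (rule eventually_compose_filterlim)
      qed
    qed
    then have m: "membership (Fuzzy_Number f) = f" by (simp add: Fuzzy_Number_inverse)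
    have "level (Fuzzy_Number f) \<alpha> = (\<lambda>t. k * t) ` level u \<alpha>" for \<alpha>
      using cl preim[of "\<lambda>y. \<alpha> \<le> y"] by (cases "\<alpha> = 0") (simp_all add: level_def m)
    then show ?thesis by blast
  qed
qed

lemma lower_upper_plus:
  assumes "0 \<le> \<alpha>" "\<alpha> \<le> 1"
  shows "lower (u + v) \<alpha> = lower u \<alpha> + lower v \<alpha>" "upper (u + v) \<alpha> = upper u \<alpha> + upper v \<alpha>"
  using level_plus[OF assms, of u v] level_interval(2)[OF assms, of u] level_interval(2)[OF assms, of v]
  by (auto simp: lower_def[of "u + v"] upper_def[of "u + v"])

lemma lower_upper_crisp:
  assumes "0 \<le> \<alpha>" "\<alpha> \<le> 1"
  shows "lower (crisp r) \<alpha> = r" "upper (crisp r) \<alpha> = r"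
  using level_crisp[OF assms] by (auto simp: lower_def upper_def)

instance fuzzy_number :: comm_monoid_add
proof
  fix a b c :: fuzzy_number
  show "a + b + c = a + (b + c)" by (rule lower_upper_eqI) (auto simp: lower_upper_plus)
  show "a + b = b + a" by (rule lower_upper_eqI) (auto simp: lower_upper_plus)
  show "0 + a = a"
    by (rule lower_upper_eqI) (auto simp: lower_upper_plus zero_fuzzy_number_def lower_upper_crisp)
qed

instantiation fuzzy_number :: metric_space
begin

definition dist_fuzzy_number :: "fuzzy_number \<Rightarrow> fuzzy_number \<Rightarrow> real" where
  "dist u v = (SUP \<alpha>\<in>{0..1}. max \<bar>lower u \<alpha> - lower v \<alpha>\<bar> \<bar>upper u \<alpha> - upper v \<alpha>\<bar>)"

definition uniformity_fuzzy_number :: "(fuzzy_number \<times> fuzzy_number) filter" where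
  "uniformity_fuzzy_number = (INF e\<in>{0 <..}. principal {(x, y). dist x y < e})"

definition open_fuzzy_number :: "fuzzy_number set \<Rightarrow> bool" where
  "open_fuzzy_number S = (\<forall>x\<in>S. \<forall>\<^sub>F (x', y) in uniformity. x' = x \<longrightarrow> y \<in> S)"

lemma dist_fuzzy_number_bdd:
  "bdd_above ((\<lambda>\<alpha>. max \<bar>lower u \<alpha> - lower v \<alpha>\<bar> \<bar>upper u \<alpha> - upper v \<alpha>\<bar>) ` {0..1})"
proof (rule bdd_aboveI2)
  fix \<alpha> :: real assume "\<alpha> \<in> {0..1}"
  then have a: "0 \<le> \<alpha>" "\<alpha> \<le> 1" by auto
  have "lower w 0 \<le> lower w \<alpha> \<and> lower w \<alpha> \<le> upper w \<alpha> \<and> upper w \<alpha> \<le> upper w 0" for w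
    using lower_upper_mono[of 0 \<alpha> w] level_interval[of \<alpha> w] a by auto
  from this[of u] this[of v]
  show "max \<bar>lower u \<alpha> - lower v \<alpha>\<bar> \<bar>upper u \<alpha> - upper v \<alpha>\<bar>
      \<le> max (upper u 0 - lower v 0) (upper v 0 - lower u 0)"
    by auto
qed

lemma dist_fuzzy_number_upper:
  assumes "0 \<le> \<alpha>" "\<alpha> \<le> 1"
  shows "\<bar>lower u \<alpha> - lower v \<alpha>\<bar> \<le> dist u v" "\<bar>upper u \<alpha> - upper v \<alpha>\<bar> \<le> dist u v"
proof -
  have "max \<bar>lower u \<alpha> - lower v \<alpha>\<bar> \<bar>upper u \<alpha> - upper v \<alpha>\<bar> \<le> dist u v"
    unfolding dist_fuzzy_number_def
    using assms dist_fuzzy_number_bdd by (intro cSUP_upper) auto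
  then show "\<bar>lower u \<alpha> - lower v \<alpha>\<bar> \<le> dist u v" "\<bar>upper u \<alpha> - upper v \<alpha>\<bar> \<le> dist u v"
    by auto
qed

lemma dist_fuzzy_number_least:
  assumes "\<And>\<alpha>. 0 \<le> \<alpha> \<Longrightarrow> \<alpha> \<le> 1 \<Longrightarrow>
    \<bar>lower u \<alpha> - lower v \<alpha>\<bar> \<le> c \<and> \<bar>upper u \<alpha> - upper v \<alpha>\<bar> \<le> c"
  shows "dist u v \<le> c"
  unfolding dist_fuzzy_number_def using assms by (intro cSUP_least) auto

instance
proof
  fix x y z :: fuzzy_number
  show "dist x y = 0 \<longleftrightarrow> x = y"
  proof
    assume "dist x y = 0"
    then show "x = y" using dist_fuzzy_number_upper[of _ x y] by (intro lower_upper_eqI) auto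
  next
    assume "x = y"
    then have "dist x y \<le> 0" by (intro dist_fuzzy_number_least) auto
    moreover have "0 \<le> dist x y" using dist_fuzzy_number_upper[of 0 x y] by linarith
    ultimately show "dist x y = 0" by simp
  qed
  show "dist x y \<le> dist x z + dist y z"
    using dist_fuzzy_number_upper[of _ x z] dist_fuzzy_number_upper[of _ y z]
    by (intro dist_fuzzy_number_least) (smt (verit))
qed (simp_all add: uniformity_fuzzy_number_def open_fuzzy_number_def)

end

definition cesaro_mean :: "(nat \<Rightarrow> fuzzy_number) \<Rightarrow> nat \<Rightarrow> fuzzy_number" where
  "cesaro_mean u n = (1 / (real n + 1)) *\<^sub>R (\<Sum>k=0..n. u k)"

definition cesaro_summable_to :: "(nat \<Rightarrow> fuzzy_number) \<Rightarrow> fuzzy_number \<Rightarrow> bool" where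
  "cesaro_summable_to u \<mu> \<longleftrightarrow> cesaro_mean u \<longlonglongrightarrow> \<mu>"

definition cesaro_summable :: "(nat \<Rightarrow> fuzzy_number) \<Rightarrow> bool" where
  "cesaro_summable u \<longleftrightarrow> (\<exists>\<mu>. cesaro_summable_to u \<mu>)"

end

theory Submission
  imports Defs
begin

text \<open>
  The estimate is the familiar one for real sequences, made uniform over the level sets. Levelwise,
  the endpoints of the partial sums are \<open>n + 1\<close> times the endpoints of the Cesaro means
  \<open>\<sigma> n\<close>, so the endpoints of the term \<open>u (n + 1)\<close> are differences of such multiples. Fuzzy
  numbers have no additive inverses in general, but their endpoints do, and this gives
  \<open>dist (u (n + 1)) 0 \<le> (n + 1) * dist (\<sigma> (n + 1)) (\<sigma> n) + dist (\<sigma> (n + 1)) 0\<close>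
  (lemma \<open>dist_term_le_cesaro_means\<close>). After division by \<open>n + 1\<close>, convergence of the means makes the
  right-hand side tend to \<open>0\<close>.

  Optimality is already visible on crisp numbers, which embed the real line isometrically and
  compatibly with Cesaro means. An unbounded \<open>lam\<close> tends to infinity along some sparse sequence of
  indices. Prescribe the partial sums to be \<open>n / lam n\<close> at those indices and \<open>0\<close> elsewhere: the means
  are then at most \<open>1 / lam n\<close> at those indices, hence tend to \<open>0\<close>, whereas the terms there are exactly
  \<open>n / lam n\<close>, because sparseness makes the preceding partial sum vanish.
\<close>

section \<open>Endpoints of Cesaro means\<close>

lemma lower_upper_scaleR_pos:
  assumes "0 \<le> \<alpha>" "\<alpha> \<le> 1" "k > 0"
  shows "lower (k *\<^sub>R u) \<alpha> = k * lower u \<alpha>" "upper (k *\<^sub>R u) \<alpha> = k * upper u \<alpha>"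
proof -
  have le: "k * lower u \<alpha> \<le> k * upper u \<alpha>"
    using level_interval(2)[OF assms(1,2), of u] assms(3) by simp
  have "level (k *\<^sub>R u) \<alpha> = {k * lower u \<alpha>..k * upper u \<alpha>}"
    using level_scaleR[OF assms(1,2), of k u] level_interval[OF assms(1,2), of u] assms(3)
    by (simp add: image_mult_atLeastAtMost)
  then show "lower (k *\<^sub>R u) \<alpha> = k * lower u \<alpha>" "upper (k *\<^sub>R u) \<alpha> = k * upper u \<alpha>"
    using le by (simp_all add: lower_def[of "k *\<^sub>R u"] upper_def[of "k *\<^sub>R u"])
qed

lemma lower_upper_sum:
  assumes "0 \<le> \<alpha>" "\<alpha> \<le> 1"
  shows "lower (\<Sum>i\<in>I. u i) \<alpha> = (\<Sum>i\<in>I. lower (u i) \<alpha>)"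
    and "upper (\<Sum>i\<in>I. u i) \<alpha> = (\<Sum>i\<in>I. upper (u i) \<alpha>)"
  using assms
  by (induction I rule: infinite_finite_induct)
     (simp_all add: lower_upper_plus lower_upper_crisp zero_fuzzy_number_def)

lemma lower_upper_cesaro_mean:
  assumes "0 \<le> \<alpha>" "\<alpha> \<le> 1"
  shows "lower (cesaro_mean u n) \<alpha> = (\<Sum>k=0..n. lower (u k) \<alpha>) / (real n + 1)"
    and "upper (cesaro_mean u n) \<alpha> = (\<Sum>k=0..n. upper (u k) \<alpha>) / (real n + 1)"
  using assms by (simp_all add: cesaro_mean_def lower_upper_scaleR_pos lower_upper_sum)

section \<open>Terms of a Cesaro summable sequence\<close>

text \<open>
  If \<open>x\<close> and \<open>y\<close> are consecutive means of a real sequence, the term between them is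
  \<open>(n + 2) * y - (n + 1) * x = (n + 1) * (y - x) + y\<close>. Applied to both endpoints at every level, with
  bounds that do not depend on the level, this yields the inequality for the metric.
\<close>

lemma dist_term_le_cesaro_means:
  "dist (u (Suc n)) (crisp 0) \<le>
     (real n + 1) * dist (cesaro_mean u (Suc n)) (cesaro_mean u n)
       + dist (cesaro_mean u (Suc n)) (crisp 0)"
    (is "_ \<le> ?B")
proof (rule dist_fuzzy_number_least)
  fix \<alpha> :: real assume \<alpha>: "0 \<le> \<alpha>" "\<alpha> \<le> 1"
  let ?s = "cesaro_mean u (Suc n)" and ?t = "cesaro_mean u n"
  have bound: "\<bar>z\<bar> \<le> ?B"
    if "z = (real n + 1) * (y - x) + y" "\<bar>y - x\<bar> \<le> dist ?s ?t" "\<bar>y\<bar> \<le> dist ?s (crisp 0)"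
    for x y z
  proof -
    have "\<bar>z\<bar> \<le> (real n + 1) * \<bar>y - x\<bar> + \<bar>y\<bar>"
      using abs_triangle_ineq[of "(real n + 1) * (y - x)" y] by (simp add: that(1) abs_mult)
    also have "\<dots> \<le> ?B"
      using that(2,3) by (intro add_mono mult_left_mono) auto
    finally show ?thesis .
  qed
  have term_of_means: "a (Suc n) = (real n + 1) *
       ((\<Sum>k=0..Suc n. a k) / (real (Suc n) + 1) - (\<Sum>k=0..n. a k) / (real n + 1))
         + (\<Sum>k=0..Suc n. a k) / (real (Suc n) + 1)" for a :: "nat \<Rightarrow> real"
  proof -
    have "x = c * ((s + x) / (c + 1) - s / c) + (s + x) / (c + 1)" if "c > 0" for x s c :: real
    proof -
      have "c * ((s + x) / (c + 1) - s / c) + (s + x) / (c + 1) =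
          (c + 1) * ((s + x) / (c + 1)) - c * (s / c)"
        by (simp only: distrib_right right_diff_distrib mult_1_left)
      then show ?thesis using that by simp
    qed
    from this[of "real n + 1" "a (Suc n)" "\<Sum>k=0..n. a k"] show ?thesis by (simp add: add.commute)
  qed
  have "\<bar>lower (u (Suc n)) \<alpha>\<bar> \<le> ?B"
    using dist_fuzzy_number_upper(1)[OF \<alpha>, of ?s ?t]
      dist_fuzzy_number_upper(1)[OF \<alpha>, of ?s "crisp 0"]
      term_of_means[of "\<lambda>k. lower (u k) \<alpha>"]
    by (intro bound[of _ "lower ?s \<alpha>" "lower ?t \<alpha>"])
       (simp_all only: lower_upper_cesaro_mean[OF \<alpha>] lower_upper_crisp[OF \<alpha>] diff_0_right)
  moreover have "\<bar>upper (u (Suc n)) \<alpha>\<bar> \<le> ?B"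
    using dist_fuzzy_number_upper(2)[OF \<alpha>, of ?s ?t]
      dist_fuzzy_number_upper(2)[OF \<alpha>, of ?s "crisp 0"]
      term_of_means[of "\<lambda>k. upper (u k) \<alpha>"]
    by (intro bound[of _ "upper ?s \<alpha>" "upper ?t \<alpha>"])
       (simp_all only: lower_upper_cesaro_mean[OF \<alpha>] lower_upper_crisp[OF \<alpha>] diff_0_right)
  ultimately show "\<bar>lower (u (Suc n)) \<alpha> - lower (crisp 0) \<alpha>\<bar> \<le> ?B \<and>
      \<bar>upper (u (Suc n)) \<alpha> - upper (crisp 0) \<alpha>\<bar> \<le> ?B"
    by (simp add: lower_upper_crisp[OF \<alpha>])
qed

lemma cesaro_summable_imp_terms_smallo:
  assumes "cesaro_summable u"
  shows "(\<lambda>n. dist (u n) (crisp 0)) \<in> o(\<lambda>n. real n)"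
proof -
  obtain \<mu> where lim: "cesaro_mean u \<longlonglongrightarrow> \<mu>"
    using assms by (auto simp: cesaro_summable_def cesaro_summable_to_def)
  let ?B = "\<lambda>n. dist (cesaro_mean u (Suc n)) (cesaro_mean u n)
      + dist (cesaro_mean u (Suc n)) (crisp 0) * inverse (real (Suc n))"
  have lim_Suc: "(\<lambda>n. cesaro_mean u (Suc n)) \<longlonglongrightarrow> \<mu>"
    by (rule LIMSEQ_Suc[OF lim])
  have "?B \<longlonglongrightarrow> dist \<mu> \<mu> + dist \<mu> (crisp 0) * 0"
    by (intro tendsto_intros lim lim_Suc LIMSEQ_inverse_real_of_nat)
  then have "?B \<longlonglongrightarrow> 0" by simp
  then have "(\<lambda>n. dist (u (Suc n)) (crisp 0) / real (Suc n)) \<longlonglongrightarrow> 0"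
  proof (rule Lim_null_comparison[rotated], intro always_eventually allI)
    fix n
    have "dist (u (Suc n)) (crisp 0) / real (Suc n) \<le>
        (real (Suc n) * dist (cesaro_mean u (Suc n)) (cesaro_mean u n)
          + dist (cesaro_mean u (Suc n)) (crisp 0)) / real (Suc n)"
      using dist_term_le_cesaro_means[of u n] by (intro divide_right_mono) (simp_all add: add.commute)
    also have "\<dots> = ?B n" by (simp add: field_simps del: of_nat_Suc)
    finally show "norm (dist (u (Suc n)) (crisp 0) / real (Suc n)) \<le> ?B n" by simp
  qed
  then have "(\<lambda>n. dist (u n) (crisp 0) / real n) \<longlonglongrightarrow> 0" by (rule LIMSEQ_imp_Suc)
  then show ?thesis
    by (rule smalloI_tendsto) (auto simp: eventually_at_top_dense)
qed

section \<open>Crisp numbers\<close>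

lemma dist_crisp: "dist (crisp a) (crisp b) = \<bar>a - b\<bar>"
proof (rule antisym)
  show "dist (crisp a) (crisp b) \<le> \<bar>a - b\<bar>"
    by (rule dist_fuzzy_number_least) (simp add: lower_upper_crisp)
  show "\<bar>a - b\<bar> \<le> dist (crisp a) (crisp b)"
    using dist_fuzzy_number_upper(1)[of 0 "crisp a" "crisp b"] by (simp add: lower_upper_crisp)
qed

lemma cesaro_mean_crisp:
  "cesaro_mean (\<lambda>k. crisp (a k)) n = crisp ((\<Sum>k=0..n. a k) / (real n + 1))"
  by (rule lower_upper_eqI) (simp add: lower_upper_cesaro_mean lower_upper_crisp)

section \<open>Optimality of the estimate\<close>

text \<open>
  The gap of at least two between consecutive chosen indices leaves room, just before each of them,
  for an index that is not chosen.
\<close>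

lemma unbounded_imp_sparse_indices:
  fixes f :: "nat \<Rightarrow> real"
  assumes pos: "\<And>n. 0 < f n" and unbounded: "f \<notin> O(\<lambda>n. 1)"
  obtains r :: "nat \<Rightarrow> nat" where "\<And>j. r j + 1 < r (Suc j)" "\<And>j. real j < f (r j)"
proof -
  have "\<exists>n>N. c < f n" for N and c :: real
  proof (rule ccontr)
    assume "\<not> ?thesis"
    then have "f n \<le> c" if "n > N" for n
      using that not_less by blast
    then have "\<forall>n>N. norm (f n) \<le> c * norm (1 :: real)"
      using pos by (simp add: abs_of_pos)
    then have "f \<in> O(\<lambda>n. 1)"
      by (intro bigoI[of _ c]) (auto simp: eventually_at_top_dense)
    with unbounded show False ..
  qed
  then have "\<exists>r. \<forall>j. real j < f (r j) \<and> r j + 1 < r (Suc j)"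
    by (intro dependent_nat_choice) blast+
  then show thesis using that by blast
qed

lemma terms_estimate_optimal:
  fixes lam :: "nat \<Rightarrow> real"
  assumes pos: "\<And>n. 0 < lam n" and unbounded: "lam \<notin> O(\<lambda>n. 1)"
  shows "\<exists>u. cesaro_summable u \<and> (\<lambda>n. dist (u n) (crisp 0)) \<notin> o(\<lambda>n. real n / lam n)"
proof -
  obtain r :: "nat \<Rightarrow> nat" where gap: "\<And>j. r j + 1 < r (Suc j)" and large: "\<And>j. real j < lam (r j)"
    using unbounded_imp_sparse_indices[OF pos unbounded] by blast
  have mono: "strict_mono r"
    using gap by (intro strict_mono_Suc_iff[THEN iffD2] allI) (meson add_lessD1)
  define S where "S n = (if n \<in> range r then real n / lam n else 0)" for n
  define a where "a n = S n - (if n = 0 then 0 else S (n - 1))" for n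
  define u where "u n = crisp (a n)" for n
  have partial_sums: "(\<Sum>k=0..n. a k) = S n" for n
    by (induction n) (simp_all add: a_def)

  have "(\<lambda>n. S n / (real n + 1)) \<longlonglongrightarrow> 0"
  proof (rule LIMSEQ_I)
    fix e :: real assume e: "0 < e"
    obtain J :: nat where J: "1 / e < real J" using reals_Archimedean2 by blast
    have "norm (S n / (real n + 1) - 0) < e" if n: "n \<ge> r J" for n
    proof (cases "n \<in> range r")
      case True
      then obtain j where j: "n = r j" by blast
      have "J \<le> j" using n by (simp add: j strict_mono_less_eq[OF mono])
      then have "1 / e < lam n" using J large[of j] by (simp add: j)
      then have "1 / lam n < e" using e pos[of n] by (simp add: field_simps)
      moreover have "S n / (real n + 1) = (real n / (real n + 1)) * (1 / lam n)"
        using True by (simp add: S_def)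
      moreover have "\<dots> \<le> 1 * (1 / lam n)"
        using pos[of n] by (intro mult_right_mono) (auto simp: less_imp_le)
      moreover have "0 \<le> S n" using pos[of n] by (simp add: S_def less_imp_le)
      ultimately have "S n / (real n + 1) < e" "0 \<le> S n" by linarith+
      then have "0 \<le> S n / (real n + 1)" "S n / (real n + 1) < e"
        by (simp_all only: divide_nonneg_pos of_nat_0_le_iff add_nonneg_pos zero_less_one)
      then show ?thesis by (simp only: diff_0_right real_norm_def abs_of_nonneg)
    qed (use e in \<open>simp add: S_def\<close>)
    then show "\<exists>N. \<forall>n\<ge>N. norm (S n / (real n + 1) - 0) < e" by blast
  qed
  from tendsto_rabs_zero[OF this] have "(\<lambda>n. dist (cesaro_mean u n) (crisp 0)) \<longlonglongrightarrow> 0"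
    unfolding u_def cesaro_mean_crisp partial_sums dist_crisp
    by (simp only: diff_0_right)
  then have "cesaro_summable u"
    unfolding cesaro_summable_def cesaro_summable_to_def
    by (subst tendsto_dist_iff) blast
  moreover have "(\<lambda>n. dist (u n) (crisp 0)) \<notin> o(\<lambda>n. real n / lam n)"
  proof
    assume "(\<lambda>n. dist (u n) (crisp 0)) \<in> o(\<lambda>n. real n / lam n)"
    from landau_o.smallD[OF this, of "1 / 2"]
    obtain N where N: "\<And>n. n \<ge> N \<Longrightarrow> dist (u n) (crisp 0) \<le> 1 / 2 * \<bar>real n / lam n\<bar>"
      by (auto simp: eventually_at_top_linorder)
    let ?n = "r (Suc N)"
    have "r (Suc N) - 1 \<noteq> r j" for j
    proof
      assume j: "r (Suc N) - 1 = r j"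
      then have "r N < r j" "r j < r (Suc N)" using gap[of N] by linarith+
      then show False by (simp add: strict_mono_less[OF mono])
    qed
    then have "S (?n - 1) = 0" by (auto simp: S_def)
    then have "a ?n = real ?n / lam ?n" by (simp add: a_def S_def)
    then have "dist (u ?n) (crisp 0) = \<bar>real ?n / lam ?n\<bar>" by (simp add: u_def dist_crisp)
    moreover have "?n \<ge> N" using strict_mono_imp_increasing[OF mono, of "Suc N"] by simp
    moreover have "real ?n / lam ?n > 0" using pos gap[of N] by simp
    ultimately show False using N[of ?n] by linarith
  qed
  ultimately show ?thesis by blast
qed

theorem theorem3p1:
  shows "(\<forall>u :: nat \<Rightarrow> fuzzy_number. cesaro_summable u \<longrightarrow>
            (\<lambda>n. dist (u n) (crisp 0)) \<in> o(\<lambda>n. real n)) \<and>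
         (\<forall>lam :: nat \<Rightarrow> real. (\<forall>n. 0 < lam n) \<and> lam \<notin> O(\<lambda>n. 1) \<longrightarrow>
            (\<exists>u :: nat \<Rightarrow> fuzzy_number. cesaro_summable u \<and>
               (\<lambda>n. dist (u n) (crisp 0)) \<notin> o(\<lambda>n. real n / lam n)))"
  using cesaro_summable_imp_terms_smallo terms_estimate_optimal by blast

end
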